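(* For every graph $G$, $$q(G;1,1+\lambda)=I(G;\lambda),$$ where $I(G;\lambda)=\sum_{k\ge 0} i_k(G)\,\lambda^k$ is the independent-set polynomial of $G$, $i_k(G)$ being the number of independent sets of $G$ of cardinality $k$ (the empty set being counted for $k=0$).
   Context: Graphs are finite and undirected; each vertex may carry at most one loop, there are no multiple edges, and the null graph (no vertices) is allowed. For $S\subseteq V(G)$, $G[S]$ is the subgraph induced by $S$ (keeping loops on vertices of $S$). A set $S\subseteq V(G)$ is independent if $G[S]$ has no edges and no loops. The adjacency matrix of $G$ is regarded as a matrix over $\mathbb{F}_2$, with diagonal entry $1$ exactly at the looped vertices; $r(G)$ and $n(G)$ denote its rank and nullity over $\mathbb{F}_2$ (both $0$ for the null graph). The two-variable interlace polynomial is $$q(G;x,y)=\sum_{S\subseteq V(G)}(x-1)^{r(G[S])}(y-1)^{n(G[S])}\in\mathbb{Z}[x,y],$$ with the convention $0^0=1$ on substitution. *)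

theory Defs
  imports
    "Graph_Theory.Graph_Theory"
    "Jordan_Normal_Form.DL_Rank"
    "Jordan_Normal_Form.Matrix_Kernel"
    "HOL-Library.Countable_Set"
    "HOL-Library.Z2"
begin

text \<open>
  A finite undirected graph, possibly with loops but without multiple edges, is a
  \<open>pair_pseudo_graph\<close>: a finite vertex set with a finite symmetric set of arcs, which are
  pairs of vertices. An edge between distinct \<open>u\<close>, \<open>v\<close> is the pair of arcs \<open>(u, v)\<close>, \<open>(v, u)\<close>;
  a loop at \<open>v\<close> is the single arc \<open>(v, v)\<close>. The vertex set may be empty.
\<close>

text \<open>
  The rows and columns are listed in the order given by \<open>from_nat_into\<close>, a fixed bijection from
  \<open>{..<card (verts G)}\<close> to the finite set \<open>verts G\<close>. Another order permutes rows and columns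
  simultaneously and changes neither rank nor nullity.
\<close>

definition adjacency_mat :: "('v, 'e) pre_digraph \<Rightarrow> bit mat" where
  "adjacency_mat G = mat (card (verts G)) (card (verts G))
     (\<lambda>(i, j). of_bool (from_nat_into (verts G) i \<rightarrow>\<^bsub>G\<^esub> from_nat_into (verts G) j))"

definition graph_rank :: "('v, 'e) pre_digraph \<Rightarrow> nat" where
  "graph_rank G = vec_space.rank (card (verts G)) (adjacency_mat G)"

definition graph_nullity :: "('v, 'e) pre_digraph \<Rightarrow> nat" where
  "graph_nullity G = kernel_dim (adjacency_mat G)"

text \<open>
  \<open>\<int>[x, y]\<close> is represented as \<open>(\<int>[x])[y]\<close>: the variable \<open>y\<close> is the outer one. Thus
  \<open>[:[:-1, 1:]:]\<close> is \<open>x - 1\<close> and \<open>[:-1, 1:]\<close> is \<open>y - 1\<close>.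
\<close>

definition interlace_poly :: "('v, 'e) pre_digraph \<Rightarrow> int poly poly" where
  "interlace_poly G = (\<Sum>S\<in>Pow (verts G).
     [:[:-1, 1:]:] ^ graph_rank (G \<restriction> S) * [:-1, 1:] ^ graph_nullity (G \<restriction> S))"

text \<open>The substitution \<open>p(a, b)\<close> of elements of a commutative ring for \<open>x\<close> and \<open>y\<close>.\<close>

definition subst_xy :: "int poly poly \<Rightarrow> 'a :: comm_ring_1 \<Rightarrow> 'a \<Rightarrow> 'a" where
  "subst_xy p a b = poly (map_poly (\<lambda>c. poly (map_poly of_int c) a) p) b"

definition indep_set :: "('v, 'e) pre_digraph \<Rightarrow> 'v set \<Rightarrow> bool" where
  "indep_set G S \<longleftrightarrow> S \<subseteq> verts G \<and> arcs (G \<restriction> S) = {}"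

definition indep_count :: "('v, 'e) pre_digraph \<Rightarrow> nat \<Rightarrow> nat" where
  "indep_count G k = card {S. indep_set G S \<and> card S = k}"

text \<open>The sum stops at \<open>card (verts G)\<close> because larger independent sets do not exist.\<close>

definition indep_poly :: "('v, 'e) pre_digraph \<Rightarrow> int poly" where
  "indep_poly G = (\<Sum>k\<le>card (verts G). monom (int (indep_count G k)) k)"

end

theory Submission
  imports Defs "Jordan_Normal_Form.Char_Poly"
begin

text \<open>
  Substituting \<open>x = 1\<close> turns the factor \<open>(x - 1) ^ r(G[S])\<close> into \<open>0 ^ r(G[S])\<close>, which is \<open>1\<close> if
  \<open>r(G[S]) = 0\<close> and \<open>0\<close> otherwise. A matrix has rank \<open>0\<close> exactly if it is the zero matrix
  (\<open>rank_eq_0_iff\<close>), and the adjacency matrix of \<open>G[S]\<close> is zero exactly if \<open>G[S]\<close> has neither edges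
  nor loops (\<open>adjacency_mat_eq_0_iff\<close>). So precisely the independent sets \<open>S\<close> survive. For them
  the nullity is \<open>|S|\<close>, since the kernel of the zero matrix is the whole space
  (\<open>kernel_dim_zero_mat\<close>), and \<open>(y - 1) ^ |S|\<close> becomes \<open>\<lambda> ^ |S|\<close> at \<open>y = 1 + \<lambda>\<close>. Collecting the
  independent sets by cardinality yields the independent-set polynomial.
\<close>

text \<open>
  A nonzero column is by itself linearly independent, so it already forces positive rank.
\<close>

lemma (in vec_space) rank_eq_0_iff:
  assumes A: "A \<in> carrier_mat n nc"
  shows "rank A = 0 \<longleftrightarrow> A = 0\<^sub>m n nc"
proof
  assume r: "rank A = 0"
  show "A = 0\<^sub>m n nc"
  proof (rule ccontr)
    assume "A \<noteq> 0\<^sub>m n nc"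
    then obtain i j where ij: "i < n" "j < nc" "A $$ (i, j) \<noteq> 0"
      using A by (auto simp: mat_eq_iff)
    have c: "col A j \<in> carrier_vec n" "col A j \<in> set (cols A)"
      using A ij by (auto simp: cols_def)
    have "col A j $ i \<noteq> 0" using A ij by simp
    then have "col A j \<noteq> 0\<^sub>v n" using ij by auto
    moreover have "span {} = {0\<^sub>v n}" by (simp add: span_empty)
    ultimately have "lin_indpt (insert (col A j) {})"
      using lin_dep_iff_in_span[of "{}" "col A j"] c finite_lin_indpt2[of "{}"] by auto
    then show False
      using rank_ge_card_indpt[OF A, of "{col A j}"] c r by simp
  qed
qed (simp add: rank_0I)

lemma kernel_dim_zero_mat: "kernel_dim (0\<^sub>m nr nc :: 'a :: field mat) = nc"
proof -
  interpret K: kernel nr nc "0\<^sub>m nr nc :: 'a mat" by unfold_locales simp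
  have "mat_kernel (0\<^sub>m nr nc :: 'a mat) = carrier_vec nc"
    by (auto simp: mat_kernel_def)
  then have "K.VK = K.NC.V" by (simp add: module_vec_def)
  then show ?thesis
    using K.kernel_dim K.NC.dim_is_n by simp
qed

lemma (in wf_digraph) adjacency_mat_eq_0_iff:
  assumes fin: "finite (verts G)"
  shows "adjacency_mat G = 0\<^sub>m (card (verts G)) (card (verts G)) \<longleftrightarrow> arcs G = {}"
proof
  let ?f = "from_nat_into (verts G)"
  assume Z: "adjacency_mat G = 0\<^sub>m (card (verts G)) (card (verts G))"
  show "arcs G = {}"
  proof (rule ccontr)
    assume "arcs G \<noteq> {}"
    then obtain e where e: "e \<in> arcs G" by blast
    have "verts G = ?f ` {..<card (verts G)}"
      using bij_betw_from_nat_into_finite[OF fin] by (simp add: bij_betw_def)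
    then obtain i j where ij: "i < card (verts G)" "j < card (verts G)"
      "tail G e = ?f i" "head G e = ?f j"
      using e tail_in_verts head_in_verts by (metis imageE lessThan_iff)
    then have "?f i \<rightarrow>\<^bsub>G\<^esub> ?f j" using e by (force simp: arcs_ends_conv)
    then have "adjacency_mat G $$ (i, j) = 1" using ij by (simp add: adjacency_mat_def)
    with Z ij show False by simp
  qed
next
  assume "arcs G = {}"
  then show "adjacency_mat G = 0\<^sub>m (card (verts G)) (card (verts G))"
    by (auto simp: adjacency_mat_def arcs_ends_conv mat_eq_iff)
qed

lemma (in wf_digraph) graph_rank_eq_0_iff:
  assumes "finite (verts G)"
  shows "graph_rank G = 0 \<longleftrightarrow> arcs G = {}"
  unfolding graph_rank_def adjacency_mat_eq_0_iff[OF assms, symmetric]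
  by (rule vec_space.rank_eq_0_iff) (simp add: adjacency_mat_def)

lemma (in wf_digraph) graph_nullity_arcless:
  assumes "finite (verts G)" "arcs G = {}"
  shows "graph_nullity G = card (verts G)"
  using assms by (simp add: graph_nullity_def kernel_dim_zero_mat flip: adjacency_mat_eq_0_iff)

text \<open>
  Evaluation of the coefficients at \<open>a\<close> is a ring homomorphism \<open>\<int>[x] \<rightarrow> R\<close>, hence so is its
  coefficientwise lift to \<open>\<int>[x][y] \<rightarrow> R[y]\<close>, which is then followed by evaluation at \<open>b\<close>.
\<close>

lemma comm_ring_hom_subst_xy:
  "comm_ring_hom (\<lambda>p. subst_xy p a b :: 'a :: comm_ring_1)"
proof -
  have "comm_ring_hom (\<lambda>c. poly (map_poly of_int c) a)"
    by unfold_locales (auto simp: hom_distribs)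
  then interpret h: map_poly_comm_ring_hom "\<lambda>c. poly (map_poly of_int c) a"
    by (simp add: map_poly_comm_ring_hom_def)
  show ?thesis
    by unfold_locales (auto simp: subst_xy_def h.hom_add h.hom_mult)
qed

lemma subst_xy_interlace_poly:
  "subst_xy (interlace_poly G) a b =
    (\<Sum>S\<in>Pow (verts G). (a - 1) ^ graph_rank (G \<restriction> S) * (b - 1) ^ graph_nullity (G \<restriction> S))"
proof -
  interpret s: comm_ring_hom "\<lambda>p. subst_xy p a b" by (rule comm_ring_hom_subst_xy)
  have "subst_xy [:[:-1, 1:]:] a b = a - 1" "subst_xy [:-1, 1:] a b = b - 1"
    by (simp_all add: subst_xy_def map_poly_pCons of_int_poly_hom.hom_uminus)
  then show ?thesis
    by (simp add: interlace_poly_def s.hom_sum s.hom_mult s.hom_power)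
qed

lemma indep_poly_eq_sum:
  assumes fin: "finite (verts G)"
  shows "indep_poly G = (\<Sum>S | indep_set G S. monom 1 (card S))"
proof -
  have fin_I: "finite {S. indep_set G S}"
    by (rule finite_subset[of _ "Pow (verts G)"]) (auto simp: indep_set_def fin)
  have "(\<Sum>S | indep_set G S. monom 1 (card S) :: int poly) =
      (\<Sum>k\<le>card (verts G). \<Sum>S\<in>{S \<in> {S. indep_set G S}. card S = k}. monom 1 (card S))"
    using fin_I fin by (intro sum.group[symmetric]) (auto simp: indep_set_def card_mono)
  also have "\<dots> = (\<Sum>k\<le>card (verts G). monom (int (indep_count G k)) k)"
    by (intro sum.cong refl) (simp add: indep_count_def of_nat_poly smult_monom)
  finally show ?thesis by (simp add: indep_poly_def)
qed

theorem (in fin_digraph) interlace_poly_at_1: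
  "subst_xy (interlace_poly G) 1 [:1, 1:] = indep_poly G"
proof -
  have summand: "(1 - 1) ^ graph_rank (G \<restriction> S) * ([:1, 1:] - 1) ^ graph_nullity (G \<restriction> S) =
      (if indep_set G S then monom 1 (card S) else (0 :: int poly))"
    if S: "S \<in> Pow (verts G)" for S
  proof -
    interpret GS: wf_digraph "G \<restriction> S" by (rule wellformed_induce_subgraph)
    have fin_S: "finite (verts (G \<restriction> S))" using S by (auto intro: finite_subset)
    have ind: "indep_set G S \<longleftrightarrow> arcs (G \<restriction> S) = {}" using S by (simp add: indep_set_def)
    have lam: "[:1, 1:] - 1 = (monom 1 1 :: int poly)"
      by (simp add: monom_altdef one_pCons)
    show ?thesis
    proof (cases "indep_set G S")
      case True
      then have "graph_rank (G \<restriction> S) = 0" "graph_nullity (G \<restriction> S) = card S"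
        using GS.graph_rank_eq_0_iff[OF fin_S] GS.graph_nullity_arcless[OF fin_S] ind by auto
      then show ?thesis using True by (simp add: lam monom_power)
    next
      case False
      then have "graph_rank (G \<restriction> S) \<noteq> 0" using GS.graph_rank_eq_0_iff[OF fin_S] ind by simp
      then show ?thesis using False by simp
    qed
  qed
  have "subst_xy (interlace_poly G) 1 [:1, 1:] =
      (\<Sum>S\<in>Pow (verts G). if indep_set G S then monom 1 (card S) else (0 :: int poly))"
    unfolding subst_xy_interlace_poly by (intro sum.cong refl summand)
  also have "\<dots> = (\<Sum>S | indep_set G S. monom 1 (card S))"
    by (rule sum.mono_neutral_cong_right) (auto simp: indep_set_def)
  finally show ?thesis by (simp add: indep_poly_eq_sum)
qed

theorem mainTheorem3:
  fixes G :: "'v pair_pre_digraph"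
  assumes "pair_pseudo_graph G"
  shows "subst_xy (interlace_poly (with_proj G)) 1 [:1, 1:] = indep_poly (with_proj G)"
proof -
  interpret pair_pseudo_graph G by fact
  show ?thesis by (rule interlace_poly_at_1)
qed

end
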